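(* Let $1\le q<\infty$, $l\in\mathbb{N}_0$, $\alpha\ge l$ and $f:\mathbb{Z}\to\mathbb{R}$ be such that $\frac{f}{1+|\cdot|^\alpha}\in\ell^q(\mathbb{Z},\mu)$. Then $\frac{e^{\cdot^2\Delta_d}\delta_{right}^lf(\cdot)}{1+|\cdot|^{\alpha-l}}\in\ell^q(\mathbb{Z},\mu)$.
   Context: $\mathbb{N}_0=\{0,1,2,\dots\}$. For $f:\mathbb{Z}\to\mathbb{R}$, $\delta_{right}f(n)=f(n)-f(n+1)$ and $\delta_{right}^l$ is its $l$-fold composition ($\delta_{right}^0f=f$). Weighted space: $\mu=\sum_{n\in\mathbb{Z}}\frac{1}{1+|n|}\delta_n$ ($\delta_n$ the Dirac measure at $n$), so $g\in\ell^q(\mathbb{Z},\mu)$ means $\sum_n|g(n)|^q\frac1{1+|n|}<\infty$. The expression $\frac{f}{1+|\cdot|^\alpha}$ is the sequence $n\mapsto\frac{f(n)}{1+|n|^\alpha}$. The discrete heat kernel is $G(t,n)=e^{-2t}I_n(2t)$, $t\ge0$, $n\in\mathbb{Z}$, with $I_n$ the modified Bessel function of the first kind of order $n$ (so $G(0,n)=1$ if $n=0$ and $0$ otherwise). For a sequence $g:\mathbb{Z}\to\mathbb{R}$, $e^{\cdot^2\Delta_d}g(\cdot)$ denotes the sequence $n\mapsto e^{n^2\Delta_d}g(n)=\sum_{j\in\mathbb{Z}}G(n^2,n-j)g(j)$. *)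

theory Defs
  imports "HOL-Analysis.Analysis"
begin

definition delta_right :: "(int \<Rightarrow> real) \<Rightarrow> int \<Rightarrow> real" where
  "delta_right f = (\<lambda>n. f n - f (n + 1))"

text \<open>
  Modified Bessel function of the first kind of integer order: the classical series
  \<open>I\<^sub>n(x) = \<Sum>k. (x/2)\<^bsup>2k+n\<^esup> / (k! \<Gamma>(k+n+1))\<close>. For negative order the terms with \<open>k + n < 0\<close>
  vanish because \<^const>\<open>rGamma\<close> is zero at the poles of \<open>\<Gamma>\<close>; all the remaining exponents
  are nonnegative.
\<close>
definition bessel_I :: "int \<Rightarrow> real \<Rightarrow> real" where
  "bessel_I n x =
     (\<Sum>k::nat. rGamma (of_int (int k + n + 1)) / fact k * (x / 2) powi (2 * int k + n))"

definition heat_kernel :: "real \<Rightarrow> int \<Rightarrow> real" where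
  "heat_kernel t n = exp (- 2 * t) * bessel_I n (2 * t)"

text \<open>
  The sum \<^const>\<open>infsum\<close> is zero by convention for a non-summable family, so statements about
  the semigroup should be accompanied by \<open>heat_defined\<close>.
\<close>
definition heat_defined :: "real \<Rightarrow> (int \<Rightarrow> real) \<Rightarrow> int \<Rightarrow> bool" where
  "heat_defined t g n \<longleftrightarrow> (\<lambda>j. heat_kernel t (n - j) * g j) summable_on UNIV"

definition heat_semigroup :: "real \<Rightarrow> (int \<Rightarrow> real) \<Rightarrow> int \<Rightarrow> real" where
  "heat_semigroup t g n = (\<Sum>\<^sub>\<infinity>j\<in>UNIV. heat_kernel t (n - j) * g j)"

text \<open>The space \<open>\<ell>\<^sup>q(\<int>, \<mu>)\<close> for \<open>\<mu> = \<Sum>n. \<delta>\<^sub>n / (1 + |n|)\<close>, \<open>1 \<le> q < \<infinity>\<close>.\<close>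
definition ell_mu :: "real \<Rightarrow> (int \<Rightarrow> real) set" where
  "ell_mu q = {g. (\<lambda>n. \<bar>g n\<bar> powr q * (1 / (1 + \<bar>real_of_int n\<bar>))) summable_on UNIV}"

text \<open>
  The weight \<open>1 + |n|\<^sup>\<beta>\<close>, \<open>\<beta> \<ge> 0\<close>. The case distinction implements \<open>|0|\<^sup>0 = 1\<close>, whereas
  \<open>0 powr 0 = 0\<close>.
\<close>
definition weight :: "real \<Rightarrow> int \<Rightarrow> real" where
  "weight \<beta> n = 1 + (if \<beta> = 0 then 1 else \<bar>real_of_int n\<bar> powr \<beta>)"

end

theory Submission
  imports Defs
begin

text \<open>
  The idea is that at time \<open>t = n\<^sup>2\<close> the heat kernel lives on the scale \<open>sqrt t = |n|\<close>, so that the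
  average at \<open>n\<close> essentially sees the data at distance \<open>|n|\<close> from the origin, and each difference
  gains a factor \<open>1 / sqrt t = 1 / |n|\<close>, which accounts for the drop of the weight from
  \<open>|n|\<^sup>\<alpha>\<close> to \<open>|n|\<^bsup>\<alpha> - l\<^esup>\<close>.

  Since the kernel decreases rapidly and \<open>f\<close> has polynomial growth, summation by parts
  (\<open>summation_by_parts_power\<close>) moves the \<open>l\<close> differences from \<open>f\<close> onto the kernel. The core is the
  estimate \<open>heat_kernel_diff_bound\<close>: for every \<open>N\<close>, uniformly in \<open>t \<ge> 0\<close> and \<open>m\<close>, the \<open>k\<close>-th difference of
  the kernel at \<open>m\<close> is at most a constant times \<open>R\<^bsup>-k-1\<^esup> (1 + |m| / R)\<^bsup>-N\<^esup>\<close> with \<open>R = sqrt (1 + t)\<close>. For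
  \<open>N = 0\<close> it is read off from the Fourier integral of the kernel, whose symbol
  \<open>exp (-2t (1 - cos x))\<close> is dominated by a Gaussian. The decay in \<open>m\<close> then follows from the
  supremum bounds alone, by the Bessel recurrence \<open>m G(t,m) = t (G(t,m-1) - G(t,m+1))\<close>: multiplication
  by \<open>m\<close> amounts to a factor \<open>t\<close> and one more difference.

  Put \<open>r = 1 + |n|\<close> and \<open>\<rho> = 1 + |j|\<close>. Taking \<open>t = n\<^sup>2\<close> and \<open>N\<close> large, the normalized operator is
  dominated by the positive kernel \<open>r / (r + \<rho>)\<^sup>2\<close> (\<open>parabolic_kernel_bound\<close>). Its row sums are bounded,
  and so are its column sums with respect to \<open>\<mu>\<close>, because \<open>1 / (r + \<rho>)\<^sup>2\<close> is symmetric and its sum over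
  \<open>j\<close> is at most \<open>2 / r\<close>. A Schur test (\<open>Schur_test\<close>), that is, Jensen's inequality together with an
  interchange of summation, yields boundedness on \<open>\<ell>\<^sup>q(\<int>, \<mu>)\<close>.
\<close>

section \<open>The Fourier representation of the heat kernel\<close>

text \<open>
  On a compact interval the exponential series of a bounded function converges uniformly, by the
  Weierstrass M-test, so it may be integrated termwise.
\<close>

lemma sums_integral_mult_exp:
  fixes F w :: "real \<Rightarrow> complex"
  assumes F: "continuous_on {a..b} F" and w: "continuous_on {a..b} w"
  shows "(\<lambda>k. integral {a..b} (\<lambda>x. F x * (w x ^ k / fact k))) sums
           integral {a..b} (\<lambda>x. F x * exp (w x))"
proof -
  have "bounded (F ` {a..b})" "bounded (w ` {a..b})"
    using F w by (auto intro!: compact_imp_bounded compact_continuous_image)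
  then obtain B W where B: "\<And>x. x \<in> {a..b} \<Longrightarrow> norm (F x) \<le> B"
     and W: "\<And>x. x \<in> {a..b} \<Longrightarrow> norm (w x) \<le> W"
    unfolding bounded_iff ball_simps by metis
  define f where "f = (\<lambda>n x. \<Sum>k<n. F x * (w x ^ k / fact k))"
  have lim: "uniform_limit {a..b} f (\<lambda>x. \<Sum>k. F x * (w x ^ k / fact k)) sequentially"
    unfolding f_def
  proof (rule Weierstrass_m_test)
    fix k x assume x: "x \<in> {a..b}"
    have "norm (F x) * (norm (w x) ^ k / fact k) \<le> B * (W ^ k / fact k)"
      using B[OF x] W[OF x] order_trans[OF norm_ge_zero W[OF x]] order_trans[OF norm_ge_zero B[OF x]]
      by (intro mult_mono divide_right_mono power_mono) auto
    thus "norm (F x * (w x ^ k / fact k)) \<le> B * (W ^ k / fact k)"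
      by (simp add: norm_mult norm_divide norm_power)
  next
    have "summable (\<lambda>k. W ^ k / fact k)"
      using summable_exp_generic[of W] by (simp add: field_simps)
    thus "summable (\<lambda>k. B * (W ^ k / fact k))"
      by (rule summable_mult)
  qed
  have ex: "(\<Sum>k. F x * (w x ^ k / fact k)) = F x * exp (w x)" for x
  proof -
    have "(\<lambda>k. w x ^ k / fact k) sums exp (w x)"
      using exp_converges[of "w x"] by (simp add: scaleR_conv_of_real field_simps)
    thus ?thesis by (metis sums_mult sums_unique)
  qed
  have cont: "continuous_on {a..b} (f n)" for n
    unfolding f_def by (intro continuous_intros F w) auto
  obtain I J where I: "\<And>n. (f n has_integral I n) {a..b}"
    and J: "((\<lambda>x. F x * exp (w x)) has_integral J) {a..b}" and IJ: "I \<longlonglongrightarrow> J"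
    using uniform_limit_integral[OF lim cont] unfolding ex by auto
  have "I n = (\<Sum>k<n. integral {a..b} (\<lambda>x. F x * (w x ^ k / fact k)))" for n
  proof -
    have "I n = integral {a..b} (f n)" using I by (rule integral_unique [symmetric])
    also have "\<dots> = (\<Sum>k<n. integral {a..b} (\<lambda>x. F x * (w x ^ k / fact k)))"
      unfolding f_def by (intro integral_sum integrable_continuous_interval continuous_intros F w) auto
    finally show ?thesis .
  qed
  hence "I = (\<lambda>n. \<Sum>k<n. integral {a..b} (\<lambda>x. F x * (w x ^ k / fact k)))" by (rule ext)
  with IJ show ?thesis
    unfolding sums_def integral_unique[OF J] by (simp only:)
qed

lemma integral_cis:
  "integral {-pi..pi} (\<lambda>x. cis (of_int p * x)) = (if p = 0 then 2 * of_real pi else 0)"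
proof (cases "p = 0")
  case True thus ?thesis by (simp add: scaleR_conv_of_real)
next
  case False
  have "((\<lambda>x. cis (of_int p * x)) has_integral
     cis (of_int p * pi) / (\<i> * of_int p) - cis (of_int p * (-pi)) / (\<i> * of_int p)) {-pi..pi}"
  proof (rule fundamental_theorem_of_calculus)
    fix x :: real
    have "((\<lambda>x. exp (\<i> * of_int p * of_real x) / (\<i> * of_int p)) has_vector_derivative
       exp (\<i> * of_int p * of_real x)) (at x within {-pi..pi})"
      using False
      by (intro has_vector_derivative_real_field [THEN has_vector_derivative_at_within])
         (auto intro!: derivative_eq_intros)
    thus "((\<lambda>x. cis (of_int p * x) / (\<i> * of_int p)) has_vector_derivative cis (of_int p * x))
        (at x within {-pi..pi})"
      by (simp add: cis_conv_exp mult_ac)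
  qed simp
  moreover have "sin (of_int p * pi) = 0" unfolding sin_zero_iff_int2 by blast
  hence "cis (of_int p * pi) = cis (of_int p * (-pi))" by (simp add: complex_eq_iff)
  ultimately show ?thesis using False by (simp add: integral_unique)
qed

text \<open>
  The exponential series of \<open>exp (t * cis x)\<close> has only nonnegative frequencies, and orthogonality
  picks out the one equal to \<open>p\<close>.
\<close>

lemma integral_exp_cis_mult_cis:
  fixes t :: real
  shows "integral {-pi..pi} (\<lambda>x. cis (- (of_int p * x)) * exp (of_real t * cis x)) =
     (if p \<ge> 0 then 2 * of_real pi * of_real t ^ nat p / fact (nat p) else 0)"
proof -
  have "integral {-pi..pi} (\<lambda>x. cis (- (of_int p * x)) * ((of_real t * cis x) ^ k / fact k)) =
     (if int k = p then 2 * of_real pi * of_real t ^ k / fact k else 0)" for k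
  proof -
    have "integral {-pi..pi} (\<lambda>x. cis (- (of_int p * x)) * ((of_real t * cis x) ^ k / fact k)) =
       integral {-pi..pi} (\<lambda>x. cis (of_int (int k - p) * x) * (of_real t ^ k / fact k))"
      by (intro integral_cong) (simp add: power_mult_distrib Complex.DeMoivre cis_mult algebra_simps)
    thus ?thesis
      using integral_cis[of "int k - p"] by (simp add: integral_mult_left)
  qed
  note A = this
  have S: "(\<lambda>k. integral {-pi..pi} (\<lambda>x. cis (- (of_int p * x)) * ((of_real t * cis x) ^ k / fact k)))
     sums integral {-pi..pi} (\<lambda>x. cis (- (of_int p * x)) * exp (of_real t * cis x))"
    by (rule sums_integral_mult_exp) (intro continuous_intros)+
  have *: "int k = p \<longleftrightarrow> p \<ge> 0 \<and> k = nat p" for k by auto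
  have "(\<lambda>k. if int k = p then 2 * complex_of_real pi * of_real t ^ k / fact k else 0) sums
     (if p \<ge> 0 then 2 * of_real pi * of_real t ^ nat p / fact (nat p) else 0)"
    unfolding * using sums_single[of "nat p" "\<lambda>k. 2 * complex_of_real pi * of_real t ^ k / fact k"]
    by (cases "p \<ge> 0") auto
  with S[unfolded A] show ?thesis by (rule sums_unique2)
qed

text \<open>
  Rewrites the terms of the Bessel series in the shape in which they arise as Fourier coefficients
  below: a coefficient of \<open>exp (t * cis x)\<close> at frequency \<open>m + k\<close>, which is zero when \<open>m + k\<close> is
  negative, times a coefficient of \<open>exp (t * cis (-x))\<close> at frequency \<open>-k\<close>.
\<close>

lemma bessel_I_term:
  "rGamma (real_of_int (int k + m + 1)) / fact k * (2 * t / 2) powi (2 * int k + m) =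
     (if m + int k \<ge> 0 then t ^ nat (m + int k) / fact (nat (m + int k)) else 0) * (t ^ k / fact k)"
proof (cases "m + int k \<ge> 0")
  case True
  define a where "a = nat (m + int k)"
  have "rGamma (real_of_int (int k + m + 1)) = 1 / fact a"
    using Gamma_fact[of a, where 'a=real] True 
    by (simp add: a_def rGamma_inverse_Gamma field_simps)
  moreover have "2 * int k + m = int (k + a)" using True by (simp add: a_def)
  ultimately show ?thesis using True
    by (simp add: a_def[symmetric] power_add del: of_nat_add)
next
  case False
  hence "real_of_int (int k + m + 1) \<in> \<int>\<^sub>\<le>\<^sub>0"
    by (intro nonpos_Ints_of_int) auto
  thus ?thesis using False by (simp add: rGamma_eq_zero_iff)
qed

text \<open>
  The symbol factorizes as \<open>exp (-2t) * exp (t * cis x) * exp (t * cis (-x))\<close>. Expanding the last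
  factor and taking the Fourier coefficient of the product of the other two leaves exactly the
  Bessel series.
\<close>

lemma heat_kernel_fourier:
  "complex_of_real (heat_kernel t m) =
     integral {-pi..pi} (\<lambda>x. of_real (exp (-2 * t * (1 - cos x))) * cis (- (of_int m * x))) / (2 * of_real pi)"
proof -
  define F where "F = (\<lambda>x. exp (of_real t * cis x) * cis (- (of_int m * x)))"
  have S: "(\<lambda>k. integral {-pi..pi} (\<lambda>x. F x * ((of_real t * cis (-x)) ^ k / fact k))) sums
        integral {-pi..pi} (\<lambda>x. F x * exp (of_real t * cis (-x)))"
    unfolding F_def by (rule sums_integral_mult_exp) (intro continuous_intros)+
  have A: "integral {-pi..pi} (\<lambda>x. F x * ((of_real t * cis (-x)) ^ k / fact k)) =
     2 * of_real pi * complex_of_real (rGamma (of_int (int k + m + 1)) / fact k * (2 * t / 2) powi (2 * int k + m))" for k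
  proof -
    have "integral {-pi..pi} (\<lambda>x. F x * ((of_real t * cis (-x)) ^ k / fact k)) =
      integral {-pi..pi} (\<lambda>x. (cis (- (of_int (m + int k) * x)) * exp (of_real t * cis x)) * (of_real t ^ k / fact k))"
      by (intro integral_cong) (simp add: F_def power_mult_distrib Complex.DeMoivre cis_mult algebra_simps)
    also have "\<dots> = (if m + int k \<ge> 0 then 2 * of_real pi * of_real t ^ nat (m + int k) / fact (nat (m + int k)) else 0) * (of_real t ^ k / fact k)"
      using integral_exp_cis_mult_cis[of "m + int k" t] by (simp add: integral_mult_left)
    finally show ?thesis unfolding bessel_I_term by simp
  qed
  have "(\<lambda>k. 2 * of_real pi * complex_of_real (rGamma (of_int (int k + m + 1)) / fact k * (2 * t / 2) powi (2 * int k + m)) / (2 * of_real pi))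
    sums (integral {-pi..pi} (\<lambda>x. F x * exp (of_real t * cis (-x))) / (2 * of_real pi))"
    using S unfolding A by (rule sums_divide)
  hence "(\<lambda>k. complex_of_real (rGamma (of_int (int k + m + 1)) / fact k * (2 * t / 2) powi (2 * int k + m)))
    sums (integral {-pi..pi} (\<lambda>x. F x * exp (of_real t * cis (-x))) / (2 * of_real pi))"
    by simp
  note T = this
  have "complex_of_real (bessel_I m (2 * t)) = integral {-pi..pi} (\<lambda>x. F x * exp (of_real t * cis (-x))) / (2 * of_real pi)"
    using sums_unique2[OF sums_of_real[OF summable_sums[OF sums_summable[OF sums_Re[OF T, unfolded Re_complex_of_real]]]] T]
    unfolding bessel_I_def .
  hence "complex_of_real (heat_kernel t m) = 
     integral {-pi..pi} (\<lambda>x. of_real (exp (-2*t)) * (F x * exp (of_real t * cis (-x)))) / (2 * of_real pi)"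
    by (simp add: heat_kernel_def integral_mult_right)
  also have "integral {-pi..pi} (\<lambda>x. of_real (exp (-2*t)) * (F x * exp (of_real t * cis (-x)))) =
     integral {-pi..pi} (\<lambda>x. of_real (exp (-2 * t * (1 - cos x))) * cis (- (of_int m * x)))"
  proof (intro integral_cong)
    fix x
    have "of_real (-2*t) + of_real t * cis x + of_real t * cis (-x) = (of_real (-2 * t * (1 - cos x)) :: complex)"
      by (simp add: complex_eq_iff algebra_simps)
    hence "exp (of_real (-2*t)) * exp (of_real t * cis x) * exp (of_real t * cis (-x)) =
        exp (of_real (-2 * t * (1 - cos x)) :: complex)"
      by (simp only: exp_add [symmetric])
    thus "of_real (exp (-2*t)) * (F x * exp (of_real t * cis (-x))) = of_real (exp (-2 * t * (1 - cos x))) * cis (- (of_int m * x))"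
      by (simp add: F_def exp_of_real[symmetric] algebra_simps del: exp_of_real)
  qed
  finally show ?thesis .
qed

section \<open>Supremum bounds for the differences of the kernel\<close>

lemma delta_right_power_Suc:
  "(delta_right ^^ Suc k) g m = (delta_right ^^ k) g m - (delta_right ^^ k) g (m + 1)"
  by (simp, subst delta_right_def, rule refl)

text \<open>
  On the Fourier side each difference multiplies the symbol by \<open>1 - cis (-x)\<close>, which vanishes to first
  order at frequency zero; this is the source of the gain \<open>t\<^bsup>-1/2\<^esup>\<close> per difference.
\<close>

lemma heat_kernel_diff_fourier:
  "complex_of_real ((delta_right ^^ k) (heat_kernel t) m) =
     integral {-pi..pi} (\<lambda>x. of_real (exp (-2 * t * (1 - cos x))) * (1 - cis (-x)) ^ k * cis (- (of_int m * x)))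
       / (2 * of_real pi)"
proof (induction k arbitrary: m)
  case 0
  show ?case by (simp add: heat_kernel_fourier)
next
  case (Suc k)
  let ?F = "\<lambda>m x. of_real (exp (-2 * t * (1 - cos x))) * (1 - cis (-x)) ^ k * cis (- (of_int m * x))"
  have int: "?F m integrable_on {-pi..pi}" for m :: int
    by (intro integrable_continuous_interval continuous_intros)
  have "complex_of_real ((delta_right ^^ Suc k) (heat_kernel t) m) =
     (integral {-pi..pi} (?F m) - integral {-pi..pi} (?F (m + 1))) / (2 * of_real pi)"
    by (simp only: delta_right_power_Suc of_real_diff Suc.IH diff_divide_distrib)
  also have "integral {-pi..pi} (?F m) - integral {-pi..pi} (?F (m + 1)) =
     integral {-pi..pi} (\<lambda>x. ?F m x - ?F (m + 1) x)"
    by (rule integral_diff [symmetric]) (fact int)+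
  also have "(\<lambda>x. ?F m x - ?F (m + 1) x) =
     (\<lambda>x. of_real (exp (-2 * t * (1 - cos x))) * (1 - cis (-x)) ^ Suc k * cis (- (of_int m * x)))"
  proof
    fix x
    have "cis (- (of_int (m + 1) * x)) = cis (-x) * cis (- (of_int m * x))"
      by (simp add: cis_mult algebra_simps)
    thus "?F m x - ?F (m + 1) x =
      of_real (exp (-2 * t * (1 - cos x))) * (1 - cis (-x)) ^ Suc k * cis (- (of_int m * x))"
      by (simp add: algebra_simps)
  qed
  finally show ?case .
qed

text \<open>
  Since \<open>1 - cos x = 2 sin\<^sup>2 (x/2)\<close>, this is Jordan's inequality \<open>sin y \<ge> 2y/\<pi>\<close> on \<open>[0, \<pi>/2]\<close>, that is,
  concavity of the sine between \<open>0\<close> and \<open>\<pi>\<close>, used at \<open>x/2\<close> as a point between \<open>0\<close> and \<open>\<pi>/2\<close>.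
\<close>

lemma one_minus_cos_ge:
  assumes "\<bar>x\<bar> \<le> pi"
  shows "2 * x\<^sup>2 / pi\<^sup>2 \<le> 1 - cos x"
proof -
  have conc: "concave_on {0..pi} sin"
    by (rule f''_le0_imp_concave[where f' = cos and f'' = "\<lambda>x. - sin x"])
       (auto intro!: derivative_eq_intros sin_ge_zero)
  have "sin ((1 - \<bar>x\<bar> / pi) *\<^sub>R 0 + (\<bar>x\<bar> / pi) *\<^sub>R (pi / 2)) \<ge>
      (1 - \<bar>x\<bar> / pi) * sin 0 + (\<bar>x\<bar> / pi) * sin (pi / 2)"
    using assms by (intro concave_onD[OF conc]) auto
  hence "\<bar>x\<bar> / pi \<le> sin (\<bar>x\<bar> / 2)" by simp
  hence "(\<bar>x\<bar> / pi)\<^sup>2 \<le> (sin (\<bar>x\<bar> / 2))\<^sup>2" by (rule power_mono) simp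
  moreover have "1 - cos x = 2 * (sin (\<bar>x\<bar> / 2))\<^sup>2"
    using cos_double_sin[of "\<bar>x\<bar> / 2"] by simp
  ultimately show ?thesis by (simp add: power_divide)
qed

lemma norm_one_minus_cis_le: "norm (1 - cis x) \<le> \<bar>x\<bar>"
proof -
  have "(norm (1 - cis x))\<^sup>2 = 2 * (1 - cos x)"
    using sin_cos_squared_add[of x] unfolding cmod_power2 by (simp add: power2_diff)
  also have "\<dots> = (2 * sin (x / 2))\<^sup>2"
    using cos_double_sin[of "x / 2"] by (simp add: power_mult_distrib)
  finally have "norm (1 - cis x) = \<bar>2 * sin (x / 2)\<bar>"
    by (metis abs_norm_cancel power2_eq_iff_nonneg abs_ge_zero power2_abs)
  also have "\<dots> \<le> \<bar>x\<bar>" using abs_sin_x_le_abs_x[of "x / 2"] by (simp add: abs_mult)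
  finally show ?thesis .
qed

text \<open>
  The \<open>Suc n\<close>-th power of \<open>1 + z \<le> exp z\<close> at \<open>z = c y / Suc n\<close>; the condition \<open>c \<le> 1\<close> lets the
  constant \<open>Suc n / c\<close> compensate for the coefficient of \<open>y\<close>.
\<close>

lemma power_le_exp:
  fixes c y :: real
  assumes "0 < c" "c \<le> 1" "0 \<le> y"
  shows "(1 + y) ^ Suc n \<le> (Suc n / c) ^ Suc n * exp (c * y)"
proof -
  have "Suc n * (1 + c * y / Suc n) = Suc n + c * y" by (simp add: field_simps)
  hence "c * (1 + y) \<le> Suc n * (1 + c * y / Suc n)"
    using assms by (simp add: distrib_left)
  hence "1 + y \<le> (Suc n * (1 + c * y / Suc n)) / c"
    using assms by (subst pos_le_divide_eq) (simp_all only: mult.commute)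
  also have "\<dots> = Suc n / c * (1 + c * y / Suc n)" by simp
  also have "\<dots> \<le> Suc n / c * exp (c * y / Suc n)"
    using assms by (intro mult_left_mono exp_ge_add_one_self) auto
  finally have "(1 + y) ^ Suc n \<le> (Suc n / c * exp (c * y / Suc n)) ^ Suc n"
    using assms by (intro power_mono) auto
  also have "\<dots> = (Suc n / c) ^ Suc n * exp (c * y)"
    by (simp only: power_mult_distrib exp_of_nat_mult [symmetric]) simp
  finally show ?thesis .
qed

lemma integral_inverse_one_plus_square:
  assumes R: "R > 0"
  shows "((\<lambda>x. 1 / (1 + (R * x)\<^sup>2)) has_integral (2 * arctan (R * pi) / R)) {-pi..pi}"
proof -
  have "((\<lambda>x. 1 / (1 + (R * x)\<^sup>2)) has_integral (arctan (R * pi) / R - arctan (R * (-pi)) / R)) {-pi..pi}"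
  proof (rule fundamental_theorem_of_calculus)
    fix x
    have "((\<lambda>x. arctan (R * x) / R) has_field_derivative 1 / (1 + (R * x)\<^sup>2)) (at x within {-pi..pi})"
      using R by (auto intro!: derivative_eq_intros simp: inverse_eq_divide)
    thus "((\<lambda>x. arctan (R * x) / R) has_vector_derivative 1 / (1 + (R * x)\<^sup>2)) (at x within {-pi..pi})"
      by (simp add: has_real_derivative_iff_has_vector_derivative)
  qed simp
  thus ?thesis by (simp add: arctan_minus)
qed

text \<open>
  The Fourier integrand is at most \<open>|x|\<^sup>k exp (-c t x\<^sup>2)\<close>. With \<open>R = sqrt (1 + t)\<close>, a Gaussian in \<open>R x\<close>
  absorbs any polynomial, so the integrand is at most a constant times \<open>R\<^bsup>-k\<^esup> / (1 + (R x)\<^sup>2)\<close>, and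
  the integral of the last factor contributes another \<open>R\<^sup>-\<^sup>1\<close>. Using \<open>1 + t\<close> in place of \<open>t\<close> makes the
  bound uniform down to \<open>t = 0\<close>; it costs only the factor \<open>exp 4\<close>, because \<open>c x\<^sup>2 \<le> 4\<close> on \<open>[-\<pi>, \<pi>]\<close>.
\<close>

lemma heat_kernel_diff_sup_bound:
  "\<exists>C. \<forall>t\<ge>0. \<forall>m. \<bar>(delta_right ^^ k) (heat_kernel t) m\<bar> \<le> C / sqrt (1 + t) ^ Suc k"
proof -
  define c where "c = 4 / pi\<^sup>2"
  have "(2::real)\<^sup>2 \<le> pi\<^sup>2" using pi_gt3 by (intro power_mono) auto
  hence c: "0 < c" "c \<le> 1" by (auto simp: c_def field_simps)
  define C where "C = exp 4 * (Suc k / c) ^ Suc k"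
  have "\<bar>(delta_right ^^ k) (heat_kernel t) m\<bar> \<le> C / sqrt (1 + t) ^ Suc k" if t: "t \<ge> 0" for t m
  proof -
    define R where "R = sqrt (1 + t)"
    have R: "R \<ge> 1" "R\<^sup>2 = 1 + t" using t by (auto simp: R_def)
    let ?F = "\<lambda>x. of_real (exp (-2 * t * (1 - cos x))) * (1 - cis (-x)) ^ k * cis (- (of_int m * x))"
    have pt: "norm (?F x) \<le> C / R ^ k * (1 / (1 + (R * x)\<^sup>2))" if x: "x \<in> {-pi..pi}" for x
    proof -
      have x': "\<bar>x\<bar> \<le> pi" using x by auto
      have xpi: "c * x\<^sup>2 \<le> 4"
      proof -
        have "\<bar>x\<bar>\<^sup>2 \<le> pi\<^sup>2" using x' by (intro power_mono) auto
        thus ?thesis by (simp add: c_def field_simps)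
      qed
      have "c * (R * x)\<^sup>2 - 4 \<le> t * (c * x\<^sup>2)"
        using xpi R by (simp add: power_mult_distrib algebra_simps)
      also have "\<dots> \<le> t * (2 * (1 - cos x))"
        using one_minus_cos_ge[OF x'] t by (intro mult_left_mono) (auto simp: c_def)
      finally have "exp (-2 * t * (1 - cos x)) \<le> exp (4 - c * (R * x)\<^sup>2)" by (simp add: algebra_simps)
      also have "\<dots> = exp 4 / exp (c * (R * x)\<^sup>2)" by (simp add: exp_diff)
      finally have E: "exp (-2 * t * (1 - cos x)) \<le> exp 4 / exp (c * (R * x)\<^sup>2)" .
      have D: "norm (1 - cis (-x)) ^ k \<le> \<bar>x\<bar> ^ k"
        using norm_one_minus_cis_le[of "-x"] by (intro power_mono) auto
      \<comment> \<open>The power \<open>|R x|\<^sup>k\<close> and the factor \<open>1 + (R x)\<^sup>2\<close> are absorbed together, as \<open>(1 + (R x)\<^sup>2) ^ Suc k\<close>.\<close>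
      have "2 * \<bar>R * x\<bar> \<le> 1 + \<bar>R * x\<bar>\<^sup>2"
        using zero_le_power2[of "\<bar>R * x\<bar> - 1"] by (simp only: power2_diff) simp
      hence "\<bar>R * x\<bar> \<le> 1 + (R * x)\<^sup>2" by simp
      hence "\<bar>R * x\<bar> ^ k * (1 + (R * x)\<^sup>2) \<le> (1 + (R * x)\<^sup>2) ^ k * (1 + (R * x)\<^sup>2)"
        by (intro mult_right_mono power_mono) auto
      also have "\<dots> \<le> (Suc k / c) ^ Suc k * exp (c * (R * x)\<^sup>2)"
        using power_le_exp[OF c, of "(R * x)\<^sup>2" k] by (simp add: mult_ac)
      finally have P: "R ^ k * \<bar>x\<bar> ^ k * (1 + (R * x)\<^sup>2) \<le> (Suc k / c) ^ Suc k * exp (c * (R * x)\<^sup>2)"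
        using R by (simp add: abs_mult power_mult_distrib)
      have pos: "R ^ k > 0" "1 + (R * x)\<^sup>2 > 0"
        using R by (auto intro: add_pos_nonneg)
      have Q: "\<bar>x\<bar> ^ k / exp (c * (R * x)\<^sup>2) \<le> (Suc k / c) ^ Suc k / (R ^ k * (1 + (R * x)\<^sup>2))"
      proof -
        have "a / b \<le> K / (d * e)" if "d * a * e \<le> K * b" "b > 0" "d > 0" "e > 0" for a b d e K :: real
          using that by (simp add: divide_simps mult_ac)
        from this[OF P _ pos] show ?thesis by simp
      qed
      have "norm (?F x) = exp (-2 * t * (1 - cos x)) * norm (1 - cis (-x)) ^ k"
        by (simp add: norm_mult norm_power)
      also have "\<dots> \<le> (exp 4 / exp (c * (R * x)\<^sup>2)) * \<bar>x\<bar> ^ k"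
        using E D by (intro mult_mono) auto
      also have "\<dots> = exp 4 * (\<bar>x\<bar> ^ k / exp (c * (R * x)\<^sup>2))" by simp
      also have "\<dots> \<le> exp 4 * ((Suc k / c) ^ Suc k / (R ^ k * (1 + (R * x)\<^sup>2)))"
        using Q by (intro mult_left_mono) auto
      finally show ?thesis by (simp add: C_def)
    qed
    have hi: "((\<lambda>x. C / R ^ k * (1 / (1 + (R * x)\<^sup>2))) has_integral C / R ^ k * (2 * arctan (R * pi) / R)) {-pi..pi}"
      using R by (intro has_integral_mult_right integral_inverse_one_plus_square) auto
    have "norm (integral {-pi..pi} ?F) \<le> integral {-pi..pi} (\<lambda>x. C / R ^ k * (1 / (1 + (R * x)\<^sup>2)))"
    proof (rule integral_norm_bound_integral)
      show "?F integrable_on {-pi..pi}"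
        by (intro integrable_continuous_interval continuous_intros)
    qed (use hi pt in \<open>auto simp: has_integral_integrable_integral\<close>)
    also have "\<dots> = C / R ^ k * (2 * arctan (R * pi) / R)" using hi by (rule integral_unique)
    also have "arctan (R * pi) \<le> pi" using arctan_ubound[of "R * pi"] pi_gt_zero by linarith
    hence "C / R ^ k * (2 * arctan (R * pi) / R) \<le> C / R ^ k * (2 * pi / R)"
      using R c
      by (intro mult_left_mono divide_right_mono) (auto simp: C_def)
    finally have "norm (integral {-pi..pi} ?F) / (2 * pi) \<le> C / R ^ Suc k"
      by (simp add: field_simps)
    moreover have "\<bar>(delta_right ^^ k) (heat_kernel t) m\<bar> = norm (integral {-pi..pi} ?F) / (2 * pi)"
      using arg_cong[OF heat_kernel_diff_fourier[of k t m], of norm] by (simp add: norm_divide)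
    ultimately show ?thesis by (simp add: R_def)
  qed
  thus ?thesis by blast
qed

section \<open>Spatial decay of the differences of the kernel\<close>

text \<open>
  Integration by parts: the derivative of \<open>exp (-2t (1 - cos x)) * cis (-m x)\<close> integrates to zero over a
  period, and \<open>2 sin x\<close> is \<open>cis x - cis (-x)\<close> up to the factor \<open>\<i>\<close>, which shifts \<open>m\<close> by \<open>\<plusminus>1\<close>.
\<close>

lemma heat_kernel_recurrence:
  "of_int m * heat_kernel t m = t * (heat_kernel t (m - 1) - heat_kernel t (m + 1))"
proof -
  let ?E = "\<lambda>x. complex_of_real (exp (-2 * t * (1 - cos x)))"
  let ?F = "\<lambda>m x. ?E x * cis (- (of_int m * x))"
  have int: "?F m integrable_on {-pi..pi}" for m :: int
    by (intro integrable_continuous_interval continuous_intros)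
  let ?D = "\<lambda>x. \<i> * (of_real t * (?F (m - 1) x - ?F (m + 1) x) - of_int m * ?F m x)"
  have D: "(?D has_integral (?F m pi - ?F m (-pi))) {-pi..pi}"
  proof (rule fundamental_theorem_of_calculus)
    fix x :: real
    have "((\<lambda>x. exp (-2 * of_real t * (1 - cos (of_real x))) * exp (- \<i> * of_int m * of_real x)) has_vector_derivative
        (-2 * of_real t * sin (of_real x) - \<i> * of_int m) *
          (exp (-2 * of_real t * (1 - cos (of_real x))) * exp (- \<i> * of_int m * of_real x))) (at x within {-pi..pi})"
      by (rule has_vector_derivative_real_field [THEN has_vector_derivative_at_within] derivative_eq_intros refl
         | (simp add: algebra_simps; fail))+
    moreover have "exp (-2 * of_real t * (1 - cos (of_real x))) * exp (- \<i> * of_int m * of_real x) = ?F m x" for x :: real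
      by (simp add: cis_conv_exp cos_of_real mult_ac flip: exp_of_real)
    moreover have "(-2 * of_real t * sin (of_real x) - \<i> * of_int m) * ?F m x = ?D x"
    proof -
      have "cis (- (of_int (m - 1) * x)) = cis x * cis (- (of_int m * x))"
           "cis (- (of_int (m + 1) * x)) = cis (-x) * cis (- (of_int m * x))"
        by (simp_all add: cis_mult algebra_simps)
      moreover have "\<i> * (cis x - cis (-x)) = - 2 * sin (of_real x)"
        by (simp add: complex_eq_iff sin_of_real)
      ultimately show ?thesis by algebra
    qed
    ultimately show "(?F m has_vector_derivative ?D x) (at x within {-pi..pi})" by simp
  qed simp
  have "?F m pi = ?F m (-pi)"
  proof -
    have "sin (of_int m * pi) = 0" unfolding sin_zero_iff_int2 by blast
    thus ?thesis by (simp add: complex_eq_iff)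
  qed
  hence "integral {-pi..pi} ?D = 0" unfolding integral_unique[OF D] by (simp only: diff_self)
  also have "integral {-pi..pi} ?D = \<i> * (of_real t * (integral {-pi..pi} (?F (m - 1)) - integral {-pi..pi} (?F (m + 1)))
       - of_int m * integral {-pi..pi} (?F m))"
    by (subst integral_mult_right integral_diff | intro integrable_diff integrable_on_mult_right int refl)+
  finally have I: "\<i> * (of_real t * (integral {-pi..pi} (?F (m - 1)) - integral {-pi..pi} (?F (m + 1)))
       - of_int m * integral {-pi..pi} (?F m)) = 0" .
  have "m * (c / p) = t * (a / p - b / p)" if "\<i> * (t * (a - b) - m * c) = 0" for a b c m p t :: complex
    using that by (simp add: diff_divide_distrib [symmetric])
  from this[OF I] have "of_int m * (integral {-pi..pi} (?F m) / (2 * of_real pi)) =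
      of_real t * (integral {-pi..pi} (?F (m - 1)) / (2 * of_real pi) - integral {-pi..pi} (?F (m + 1)) / (2 * of_real pi))" .
  hence "of_int m * complex_of_real (heat_kernel t m) =
      of_real t * (complex_of_real (heat_kernel t (m - 1)) - complex_of_real (heat_kernel t (m + 1)))"
    by (simp only: heat_kernel_fourier)
  hence "complex_of_real (of_int m * heat_kernel t m) = complex_of_real (t * (heat_kernel t (m - 1) - heat_kernel t (m + 1)))"
    by simp
  thus ?thesis by (simp only: of_real_eq_iff)
qed

text \<open>
  Leibniz rule for the differences of a product with the linear sequence \<open>m\<close>. For \<open>k = 0\<close> the truncated
  \<open>k - 1\<close> is harmless because of the factor \<open>k\<close>.
\<close>

lemma delta_right_power_mult_index:
  "(delta_right ^^ k) (\<lambda>m. of_int m * g m) m =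
     of_int m * (delta_right ^^ k) g m - of_nat k * (delta_right ^^ (k - 1)) g (m + 1)"
proof (induction k arbitrary: m)
  case (Suc k)
  show ?case
  proof (cases k)
    case 0
    thus ?thesis by (simp add: delta_right_def algebra_simps)
  next
    case (Suc j)
    have *: "(delta_right ^^ k) g (m + 1) = (delta_right ^^ (k - 1)) g (m + 1) - (delta_right ^^ (k - 1)) g (m + 1 + 1)"
      using delta_right_power_Suc[of j g "m + 1"] Suc by (simp only: diff_Suc_1)
    thus ?thesis
      using arg_cong[OF *, of "\<lambda>z. (1 + real k) * z"]
      unfolding delta_right_power_Suc Suc.IH by (simp add: algebra_simps)
  qed
qed simp

lemma delta_right_power_central:
  "(delta_right ^^ k) (\<lambda>m. t * (g (m - 1) - g (m + 1))) m =
     t * ((delta_right ^^ Suc k) g (m - 1) + (delta_right ^^ Suc k) g m)"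
proof -
  have "(delta_right ^^ k) (\<lambda>m. t * (g (m - 1) - g (m + 1))) m =
     t * ((delta_right ^^ k) g (m - 1) - (delta_right ^^ k) g (m + 1))"
    by (induction k arbitrary: m) (simp, simp only: delta_right_power_Suc, simp add: algebra_simps)
  thus ?thesis unfolding delta_right_power_Suc by simp
qed

lemma heat_kernel_diff_recurrence:
  "of_int m * (delta_right ^^ k) (heat_kernel t) m =
     t * ((delta_right ^^ Suc k) (heat_kernel t) (m - 1) + (delta_right ^^ Suc k) (heat_kernel t) m)
     + of_nat k * (delta_right ^^ (k - 1)) (heat_kernel t) (m + 1)"
  using delta_right_power_mult_index[of k "heat_kernel t" m]
    delta_right_power_central[of k t "heat_kernel t" m]
  by (simp add: heat_kernel_recurrence)

text \<open>
  By \<open>heat_kernel_diff_recurrence\<close>, multiplication by \<open>m\<close> either trades a factor \<open>t\<close> for one more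
  difference or removes one difference. In terms of \<open>R = sqrt (1 + t)\<close> a difference is worth \<open>R\<^sup>-\<^sup>1\<close>, so
  either way the bound grows by a single factor \<open>R\<close>. Thus the supremum bounds for all orders \<open>k\<close>
  together give polynomial decay of every degree on the parabolic scale \<open>R\<close>.
\<close>

lemma heat_kernel_diff_bound:
  "\<exists>C. \<forall>t\<ge>0. \<forall>m. \<bar>(delta_right ^^ k) (heat_kernel t) m\<bar> * (sqrt (1 + t) + \<bar>of_int m\<bar>) ^ N
       \<le> C * sqrt (1 + t) ^ N / sqrt (1 + t) ^ Suc k"
proof (induction N arbitrary: k)
  case 0
  show ?case using heat_kernel_diff_sup_bound[of k] by simp
next
  case (Suc N)
  let ?G = "\<lambda>k t. (delta_right ^^ k) (heat_kernel t)"
  obtain A where A: "\<And>t m. t \<ge> 0 \<Longrightarrow> \<bar>?G k t m\<bar> * (sqrt (1 + t) + \<bar>of_int m\<bar>) ^ N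
       \<le> A * sqrt (1 + t) ^ N / sqrt (1 + t) ^ Suc k" using Suc.IH[of k] by blast
  obtain B where B: "\<And>t m. t \<ge> 0 \<Longrightarrow> \<bar>?G (Suc k) t m\<bar> * (sqrt (1 + t) + \<bar>of_int m\<bar>) ^ N
       \<le> B * sqrt (1 + t) ^ N / sqrt (1 + t) ^ Suc (Suc k)" using Suc.IH[of "Suc k"] by blast
  obtain D where D: "\<And>t m. t \<ge> 0 \<Longrightarrow> \<bar>?G (k - 1) t m\<bar> * (sqrt (1 + t) + \<bar>of_int m\<bar>) ^ N
       \<le> D * sqrt (1 + t) ^ N / sqrt (1 + t) ^ Suc (k - 1)" using Suc.IH[of "k - 1"] by blast
  have "\<bar>?G k t m\<bar> * (sqrt (1 + t) + \<bar>of_int m\<bar>) ^ Suc N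
     \<le> (A + 2 ^ N * (2 * B + k * D)) * sqrt (1 + t) ^ Suc N / sqrt (1 + t) ^ Suc k" if t: "t \<ge> 0" for t m
  proof -
    define R where "R = sqrt (1 + t)"
    have R: "R \<ge> 1" "t \<le> R\<^sup>2" using t by (auto simp: R_def)
    define w where "w = (\<lambda>m::int. (R + \<bar>of_int m\<bar>) ^ N)"
    define Q where "Q = R ^ Suc N / R ^ Suc k"
    \<comment> \<open>The recurrence involves the neighbours of \<open>m\<close>; moving there costs a factor of at most
      \<open>2\<close> in \<open>R + |m|\<close>, since \<open>R \<ge> 1\<close>.\<close>
    have shift: "w m \<le> 2 ^ N * w m'" if "\<bar>m - m'\<bar> \<le> 1" for m m'
    proof -
      have "\<bar>real_of_int m\<bar> \<le> 1 + \<bar>real_of_int m'\<bar>" using that by linarith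
      hence "R + \<bar>of_int m\<bar> \<le> 2 * (R + \<bar>of_int m'\<bar>)" using R(1) by (smt (verit))
      hence "w m \<le> (2 * (R + \<bar>of_int m'\<bar>)) ^ N" unfolding w_def using R by (intro power_mono) auto
      thus ?thesis by (simp only: w_def power_mult_distrib)
    qed
    have shift': "\<bar>x\<bar> * w m \<le> 2 ^ N * (\<bar>x\<bar> * w m')" if "\<bar>m - m'\<bar> \<le> 1" for x m m'
      using mult_left_mono[OF shift[OF that], of "\<bar>x\<bar>"] by (simp add: mult_ac)
    have b1: "R * (\<bar>?G k t m\<bar> * w m) \<le> A * Q"
    proof -
      have "R * (\<bar>?G k t m\<bar> * w m) \<le> R * (A * R ^ N / R ^ Suc k)"
        using A[OF t, of m] R by (intro mult_left_mono) (auto simp: R_def w_def)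
      thus ?thesis using R by (simp add: Q_def)
    qed
    have b2: "t * (\<bar>?G (Suc k) t m'\<bar> * w m') \<le> B * Q" for m'
    proof -
      have nn: "0 \<le> \<bar>?G (Suc k) t m'\<bar> * w m'" using R by (simp add: w_def)
      have "t * (\<bar>?G (Suc k) t m'\<bar> * w m') \<le> R\<^sup>2 * (B * R ^ N / R ^ Suc (Suc k))"
        using B[OF t, of m'] R nn t by (intro mult_mono) (auto simp: R_def w_def)
      thus ?thesis using R by (simp add: Q_def power2_eq_square)
    qed
    have b3: "k * (\<bar>?G (k - 1) t m'\<bar> * w m') \<le> k * (D * Q)" for m'
    proof (cases "k = 0")
      case False
      have "\<bar>?G (k - 1) t m'\<bar> * w m' \<le> D * R ^ N / R ^ k"
        using D[OF t, of m'] False by (simp add: R_def w_def)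
      also have "\<dots> = D * Q" using R by (simp add: Q_def)
      finally show ?thesis by (intro mult_left_mono) auto
    qed simp
    have "\<bar>of_int m\<bar> * \<bar>?G k t m\<bar> = \<bar>t * (?G (Suc k) t (m - 1) + ?G (Suc k) t m) + k * ?G (k - 1) t (m + 1)\<bar>"
      by (simp only: abs_mult [symmetric] heat_kernel_diff_recurrence)
    also have "\<dots> \<le> t * (\<bar>?G (Suc k) t (m - 1)\<bar> + \<bar>?G (Suc k) t m\<bar>) + k * \<bar>?G (k - 1) t (m + 1)\<bar>"
      using t by (intro order_trans[OF abs_triangle_ineq] add_mono) (auto simp: abs_mult intro!: mult_left_mono)
    finally have "\<bar>of_int m\<bar> * \<bar>?G k t m\<bar> * w m \<le>
        (t * (\<bar>?G (Suc k) t (m - 1)\<bar> + \<bar>?G (Suc k) t m\<bar>) + k * \<bar>?G (k - 1) t (m + 1)\<bar>) * w m"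
      using R by (intro mult_right_mono) (auto simp: w_def)
    also have "\<dots> = t * (\<bar>?G (Suc k) t (m - 1)\<bar> * w m) + t * (\<bar>?G (Suc k) t m\<bar> * w m)
         + k * (\<bar>?G (k - 1) t (m + 1)\<bar> * w m)" by (simp add: algebra_simps)
    also have "\<dots> \<le> t * (2 ^ N * (\<bar>?G (Suc k) t (m - 1)\<bar> * w (m - 1))) + t * (2 ^ N * (\<bar>?G (Suc k) t m\<bar> * w m))
         + k * (2 ^ N * (\<bar>?G (k - 1) t (m + 1)\<bar> * w (m + 1)))"
      using t by (intro add_mono mult_left_mono shift') auto
    also have "\<dots> = 2 ^ N * (t * (\<bar>?G (Suc k) t (m - 1)\<bar> * w (m - 1)) + t * (\<bar>?G (Suc k) t m\<bar> * w m)
         + k * (\<bar>?G (k - 1) t (m + 1)\<bar> * w (m + 1)))" by (simp add: algebra_simps)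
    also have "\<dots> \<le> 2 ^ N * (B * Q + B * Q + k * (D * Q))"
      by (intro mult_left_mono add_mono b2 b3) auto
    finally have b: "\<bar>of_int m\<bar> * \<bar>?G k t m\<bar> * w m \<le> 2 ^ N * (B * Q + B * Q + k * (D * Q))" .
    have "\<bar>?G k t m\<bar> * (R + \<bar>of_int m\<bar>) ^ Suc N = R * (\<bar>?G k t m\<bar> * w m) + \<bar>of_int m\<bar> * \<bar>?G k t m\<bar> * w m"
      by (simp add: w_def algebra_simps)
    also have "\<dots> \<le> A * Q + 2 ^ N * (B * Q + B * Q + k * (D * Q))" by (intro add_mono b1 b)
    also have "\<dots> = (A + 2 ^ N * (2 * B + k * D)) * Q" by (simp add: algebra_simps)
    finally show ?thesis unfolding Q_def R_def times_divide_eq_right .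
  qed
  thus ?case by blast
qed

section \<open>Weighted Schur test\<close>

text \<open>
  Telescoping: for \<open>s > 0\<close>, \<open>1 / (s + 1)\<^sup>2\<close> is at most \<open>1 / s - 1 / (s + 1)\<close>, and every \<open>|j|\<close> occurs at most twice.
\<close>

lemma sum_inverse_square_int_le:
  fixes r :: real
  assumes r: "r > 0"
  shows "(\<lambda>j::int. 1 / (r + (1 + \<bar>of_int j\<bar>))\<^sup>2) summable_on UNIV"
    and "(\<Sum>\<^sub>\<infinity>j::int. 1 / (r + (1 + \<bar>of_int j\<bar>))\<^sup>2) \<le> 2 / r"
proof -
  let ?f = "\<lambda>j::int. 1 / (r + (1 + \<bar>of_int j\<bar>))\<^sup>2"
  have interval: "sum ?f {- int n..int n} \<le> 2 / r - 2 / (r + 1 + n)" for n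
  proof (induction n)
    case 0
    have "1 / (r + 1)\<^sup>2 \<le> 2 / (r * (r + 1))"
      using r by (intro frac_le) (auto simp: power2_eq_square intro!: mult_mono)
    also have "\<dots> = 2 / r - 2 / (r + 1)" using r by (simp add: field_simps)
    finally show ?case by simp
  next
    case (Suc n)
    have "{- int (Suc n)..int (Suc n)} = insert (- int (Suc n)) (insert (int (Suc n)) {- int n..int n})"
      by auto
    hence "sum ?f {- int (Suc n)..int (Suc n)} = 2 / (r + 2 + n)\<^sup>2 + sum ?f {- int n..int n}"
      by (simp add: add_ac)
    also have "2 / (r + 2 + n)\<^sup>2 \<le> 2 / ((r + 1 + n) * (r + 2 + n))"
      using r by (intro divide_left_mono) (auto simp: power2_eq_square intro!: mult_mono)
    also have "\<dots> = 2 / (r + 1 + n) - 2 / (r + 2 + n)"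
      using r by (simp add: field_simps)
    finally show ?case using Suc.IH by (simp add: add_ac)
  qed
  have fin: "sum ?f F \<le> 2 / r" if F: "finite F" for F
  proof -
    obtain n where n: "\<And>j. j \<in> F \<Longrightarrow> nat \<bar>j\<bar> \<le> n"
      using F finite_nat_set_iff_bounded_le[of "(\<lambda>j. nat \<bar>j\<bar>) ` F"] by auto
    have "F \<subseteq> {- int n..int n}"
    proof
      fix j assume "j \<in> F" 
      from n[OF this] show "j \<in> {- int n..int n}" by auto
    qed
    hence "sum ?f F \<le> sum ?f {- int n..int n}" by (intro sum_mono2) auto
    also have "\<dots> \<le> 2 / r - 2 / (r + 1 + n)" by (rule interval)
    also have "\<dots> \<le> 2 / r" using r by simp
    finally show ?thesis .
  qed
  show S: "?f summable_on UNIV"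
    by (rule nonneg_bdd_above_summable_on) (auto intro!: bdd_aboveI2[of _ _ "2 / r"] fin)
  show "infsum ?f UNIV \<le> 2 / r"
    by (rule infsum_le_finite_sums[OF S]) (rule fin)
qed

lemma le_one_plus_powr:
  fixes x q :: real
  assumes "0 \<le> x" "1 \<le> q"
  shows "x \<le> 1 + x powr q"
proof (cases "x \<le> 1")
  case False
  hence "x powr 1 \<le> x powr q" using assms by (intro powr_mono) auto
  thus ?thesis using assms by simp
qed (use powr_ge_zero[of x q] in linarith)

text \<open>
  Young's inequality, in the form that the convex function \<open>h \<mapsto> h powr q\<close> lies above its tangent at \<open>s\<close>.
\<close>

lemma powr_tangent_line:
  fixes h s q :: real
  assumes "0 \<le> h" "0 < s" "1 \<le> q"
  shows "q * (s powr (q - 1) * h) \<le> h powr q + (q - 1) * s powr q"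
proof (cases "h = 0")
  case False
  have "(h powr q) powr (1 / q) * (s powr q) powr (1 - 1 / q) \<le> 1 / q * h powr q + (1 - 1 / q) * s powr q"
    using assms False by (intro Youngs_inequality_0) auto
  also have "(h powr q) powr (1 / q) * (s powr q) powr (1 - 1 / q) = h * s powr (q - 1)"
    using assms False by (simp add: powr_powr right_diff_distrib)
  finally have "q * (h * s powr (q - 1)) \<le> q * (1 / q * h powr q + (1 - 1 / q) * s powr q)"
    using assms by (intro mult_left_mono) auto
  also have "\<dots> = h powr q + (q - 1) * s powr q" using assms by (simp add: field_simps)
  finally show ?thesis by (simp add: mult_ac)
qed (use assms in simp)

text \<open>
  Jensen's inequality for a weight \<open>K\<close> of total mass at most \<open>S\<close>. Summing the tangent inequality at the
  point \<open>s\<close> equal to the weighted sum of \<open>h\<close> divided by \<open>S\<close> gives the claim.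
\<close>

lemma infsum_powr_le:
  fixes K h :: "'a \<Rightarrow> real"
  assumes q: "1 \<le> q" and nonneg: "\<And>x. x \<in> A \<Longrightarrow> 0 \<le> K x" "\<And>x. x \<in> A \<Longrightarrow> 0 \<le> h x"
    and K: "K summable_on A" "infsum K A \<le> S" and S: "0 < S"
    and Kh: "(\<lambda>x. K x * h x powr q) summable_on A"
  shows "(\<lambda>x. K x * h x) summable_on A"
    and "infsum (\<lambda>x. K x * h x) A powr q \<le> S powr (q - 1) * infsum (\<lambda>x. K x * h x powr q) A"
proof -
  show sm: "(\<lambda>x. K x * h x) summable_on A"
  proof (rule summable_on_comparison_test)
    show "(\<lambda>x. K x + K x * h x powr q) summable_on A" by (intro summable_on_add K Kh)
    show "K x * h x \<le> K x + K x * h x powr q" if "x \<in> A" for x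
      using mult_left_mono[OF le_one_plus_powr[OF nonneg(2)[OF that] q] nonneg(1)[OF that]]
      by (simp add: algebra_simps)
  qed (use nonneg in auto)
  define a where "a = infsum (\<lambda>x. K x * h x) A"
  define P where "P = infsum (\<lambda>x. K x * h x powr q) A"
  have a0: "a \<ge> 0" and P0: "P \<ge> 0" unfolding a_def P_def using nonneg by (auto intro!: infsum_nonneg)
  have "a powr q \<le> S powr (q - 1) * P"
  proof (cases "a = 0")
    case True
    thus ?thesis using P0 by simp
  next
    case False
    define s where "s = a / S"
    have s: "s > 0" using False a0 S by (simp add: s_def)
    have "infsum (\<lambda>x. (q * s powr (q - 1)) * (K x * h x)) A \<le>
        infsum (\<lambda>x. K x * h x powr q + ((q - 1) * s powr q) * K x) A"
    proof (rule infsum_mono)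
      fix x assume x: "x \<in> A"
      show "(q * s powr (q - 1)) * (K x * h x) \<le> K x * h x powr q + ((q - 1) * s powr q) * K x"
        using mult_left_mono[OF powr_tangent_line[OF nonneg(2)[OF x] s q] nonneg(1)[OF x]]
        by (simp add: algebra_simps)
    qed (intro summable_on_add summable_on_cmult_right sm K Kh)+
    also have "infsum (\<lambda>x. K x * h x powr q + ((q - 1) * s powr q) * K x) A = P + ((q - 1) * s powr q) * infsum K A"
      unfolding P_def using Kh K by (subst infsum_add) (auto intro: summable_on_cmult_right simp: infsum_cmult_right)
    also have "\<dots> \<le> P + ((q - 1) * s powr q) * S"
      using K q by (intro add_left_mono mult_left_mono) auto
    also have "infsum (\<lambda>x. (q * s powr (q - 1)) * (K x * h x)) A = q * s powr (q - 1) * a"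
      unfolding a_def using sm by (simp add: infsum_cmult_right)
    also have "a = s * S" using S by (simp add: s_def)
    also have "q * s powr (q - 1) * (s * S) = q * s powr q * S"
      using s by (simp add: powr_diff)
    finally have "s powr q * S \<le> P" by (simp add: algebra_simps)
    hence "S powr (q - 1) * (s powr q * S) \<le> S powr (q - 1) * P" by (intro mult_left_mono) auto
    also have "S powr (q - 1) * (s powr q * S) = a powr q"
      using S a0 by (simp add: s_def powr_divide powr_diff)
    finally show ?thesis .
  qed
  thus "infsum (\<lambda>x. K x * h x) A powr q \<le> S powr (q - 1) * infsum (\<lambda>x. K x * h x powr q) A"
    by (simp add: a_def P_def)
qed

text \<open>
  Jensen's inequality in each row reduces the claim to the case \<open>q = 1\<close>, where interchanging the two
  sums leaves the column sums of \<open>K\<close>.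
\<close>

lemma Schur_test:
  fixes K :: "'a \<Rightarrow> 'b \<Rightarrow> real"
  assumes q: "1 \<le> q" and S: "0 < S"
    and nonneg: "\<And>n j. 0 \<le> K n j" "\<And>j. 0 \<le> h j" "\<And>n. 0 < v n"
    and row: "\<And>n. K n summable_on UNIV" "\<And>n. infsum (K n) UNIV \<le> S"
    and col: "\<And>j. (\<lambda>n. v n * K n j) summable_on UNIV" "\<And>j. infsum (\<lambda>n. v n * K n j) UNIV \<le> S * u j"
    and h: "(\<lambda>j. u j * h j powr q) summable_on UNIV"
  shows "(\<lambda>j. K n j * h j) summable_on UNIV"
    and "(\<lambda>n. v n * infsum (\<lambda>j. K n j * h j) UNIV powr q) summable_on UNIV"
proof -
  let ?F = "\<lambda>n j. v n * (K n j * h j powr q)"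
  have "(\<lambda>(j, n). ?F n j) summable_on (UNIV \<times> UNIV)"
  proof (rule summable_on_SigmaI)
    show "((\<lambda>n. case (j, n) of (j, n) \<Rightarrow> ?F n j) has_sum (infsum (\<lambda>n. v n * K n j) UNIV * h j powr q)) UNIV" for j
      using has_sum_cmult_left[OF has_sum_infsum[OF col(1)[of j]], of "h j powr q"] by (simp add: mult.assoc)
    show "(\<lambda>j. infsum (\<lambda>n. v n * K n j) UNIV * h j powr q) summable_on UNIV"
    proof (rule summable_on_comparison_test)
      show "(\<lambda>j. S * (u j * h j powr q)) summable_on UNIV" by (intro summable_on_cmult_right h)
      show "infsum (\<lambda>n. v n * K n j) UNIV * h j powr q \<le> S * (u j * h j powr q)" for j
        using mult_right_mono[OF col(2)[of j], of "h j powr q"] by (simp add: mult.assoc)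
      show "0 \<le> infsum (\<lambda>n. v n * K n j) UNIV * h j powr q" for j
        using nonneg by (intro mult_nonneg_nonneg infsum_nonneg) (auto intro: less_imp_le)
    qed
  qed (use nonneg in \<open>auto intro!: mult_nonneg_nonneg intro: less_imp_le\<close>)
  hence F: "(\<lambda>(n, j). ?F n j) summable_on (UNIV \<times> UNIV)"
    by (subst (asm) summable_on_swap) (simp add: case_prod_unfold)
  have rowF: "(\<lambda>j. K n j * h j powr q) summable_on UNIV" for n
  proof -
    have "(\<lambda>j. ?F n j) summable_on UNIV" by (rule summable_on_SigmaD1[OF F]) simp
    thus ?thesis using nonneg(3)[of n] by (simp add: summable_on_cmult_right')
  qed
  note J = infsum_powr_le[OF q nonneg(1,2) row S rowF]
  show "(\<lambda>j. K n j * h j) summable_on UNIV" by (rule J)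
  show "(\<lambda>n. v n * infsum (\<lambda>j. K n j * h j) UNIV powr q) summable_on UNIV"
  proof (rule summable_on_comparison_test)
    show "(\<lambda>n. S powr (q - 1) * infsum (?F n) UNIV) summable_on UNIV"
      using summable_on_Sigma_banach[OF F] by (intro summable_on_cmult_right)
    show "v n * infsum (\<lambda>j. K n j * h j) UNIV powr q \<le> S powr (q - 1) * infsum (?F n) UNIV" for n
    proof -
      have "v n * infsum (\<lambda>j. K n j * h j) UNIV powr q \<le>
          v n * (S powr (q - 1) * infsum (\<lambda>j. K n j * h j powr q) UNIV)"
        using nonneg(3)[of n] by (intro mult_left_mono J(2)) auto
      thus ?thesis by (simp add: infsum_cmult_right' mult_ac)
    qed
  qed (use less_imp_le[OF nonneg(3)] in auto)
qed

section \<open>Summation by parts\<close>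

definition rapidly_decreasing :: "(int \<Rightarrow> real) \<Rightarrow> bool" where
  "rapidly_decreasing g \<longleftrightarrow> (\<forall>N. \<exists>C. \<forall>m. \<bar>g m\<bar> * (1 + \<bar>of_int m\<bar>) ^ N \<le> C)"

definition polynomially_bounded :: "(int \<Rightarrow> real) \<Rightarrow> bool" where
  "polynomially_bounded f \<longleftrightarrow> (\<exists>C M. \<forall>j. \<bar>f j\<bar> \<le> C * (1 + \<bar>of_int j\<bar>) ^ M)"

lemma rapidly_decreasing_shift:
  assumes "rapidly_decreasing g"
  shows "rapidly_decreasing (\<lambda>m. g (m + 1))"
  unfolding rapidly_decreasing_def
proof
  fix N
  obtain C where C: "\<And>m. \<bar>g m\<bar> * (1 + \<bar>of_int m\<bar>) ^ N \<le> C"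
    using assms unfolding rapidly_decreasing_def by blast
  have "\<bar>g (m + 1)\<bar> * (1 + \<bar>of_int m\<bar>) ^ N \<le> 2 ^ N * C" for m
  proof -
    have "\<bar>g (m + 1)\<bar> * (1 + \<bar>real_of_int m\<bar>) ^ N \<le> \<bar>g (m + 1)\<bar> * (2 * (1 + \<bar>of_int (m + 1)\<bar>)) ^ N"
      by (intro mult_left_mono power_mono) (auto simp: abs_if)
    also have "\<dots> = 2 ^ N * (\<bar>g (m + 1)\<bar> * (1 + \<bar>of_int (m + 1)\<bar>) ^ N)"
      by (simp only: power_mult_distrib mult_ac)
    also have "\<dots> \<le> 2 ^ N * C" by (intro mult_left_mono C) auto
    finally show ?thesis .
  qed
  thus "\<exists>C. \<forall>m. \<bar>g (m + 1)\<bar> * (1 + \<bar>of_int m\<bar>) ^ N \<le> C" by blast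
qed

lemma rapidly_decreasing_diff:
  assumes "rapidly_decreasing f" "rapidly_decreasing g"
  shows "rapidly_decreasing (\<lambda>m. f m - g m)"
  unfolding rapidly_decreasing_def
proof
  fix N
  obtain C D where C: "\<And>m. \<bar>f m\<bar> * (1 + \<bar>of_int m\<bar>) ^ N \<le> C" and D: "\<And>m. \<bar>g m\<bar> * (1 + \<bar>of_int m\<bar>) ^ N \<le> D"
    using assms unfolding rapidly_decreasing_def by metis
  have "\<bar>f m - g m\<bar> * (1 + \<bar>of_int m\<bar>) ^ N \<le> C + D" for m
  proof -
    have "\<bar>f m - g m\<bar> * (1 + \<bar>real_of_int m\<bar>) ^ N \<le> (\<bar>f m\<bar> + \<bar>g m\<bar>) * (1 + \<bar>of_int m\<bar>) ^ N"
      by (intro mult_right_mono) auto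
    thus ?thesis using C[of m] D[of m] by (simp add: distrib_right)
  qed
  thus "\<exists>C. \<forall>m. \<bar>f m - g m\<bar> * (1 + \<bar>of_int m\<bar>) ^ N \<le> C" by blast
qed

lemma rapidly_decreasing_delta_right:
  "rapidly_decreasing g \<Longrightarrow> rapidly_decreasing (delta_right g)"
  unfolding delta_right_def by (intro rapidly_decreasing_diff rapidly_decreasing_shift)

lemma polynomially_bounded_shift:
  assumes "polynomially_bounded f"
  shows "polynomially_bounded (\<lambda>j. f (j + 1))"
proof -
  obtain C M where C: "\<And>j. \<bar>f j\<bar> \<le> C * (1 + \<bar>of_int j\<bar>) ^ M"
    using assms unfolding polynomially_bounded_def by blast
  have C0: "C \<ge> 0" using C[of 0] by simp
  have "\<bar>f (j + 1)\<bar> \<le> (C * 2 ^ M) * (1 + \<bar>of_int j\<bar>) ^ M" for j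
  proof -
    have "\<bar>f (j + 1)\<bar> \<le> C * (1 + \<bar>of_int (j + 1)\<bar>) ^ M" by (rule C)
    also have "\<dots> \<le> C * (2 * (1 + \<bar>of_int j\<bar>)) ^ M"
      using C0 by (intro mult_left_mono power_mono) (auto simp: abs_if)
    also have "\<dots> = (C * 2 ^ M) * (1 + \<bar>of_int j\<bar>) ^ M" by (simp only: power_mult_distrib mult_ac)
    finally show ?thesis .
  qed
  thus ?thesis unfolding polynomially_bounded_def by blast
qed

lemma polynomially_bounded_diff:
  assumes "polynomially_bounded f" "polynomially_bounded g"
  shows "polynomially_bounded (\<lambda>j. f j - g j)"
proof -
  obtain C M D L where C: "\<And>j. \<bar>f j\<bar> \<le> C * (1 + \<bar>of_int j\<bar>) ^ M" and D: "\<And>j. \<bar>g j\<bar> \<le> D * (1 + \<bar>of_int j\<bar>) ^ L"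
    using assms unfolding polynomially_bounded_def by metis
  have "C \<ge> 0" "D \<ge> 0" using C[of 0] D[of 0] by auto
  have "\<bar>f j - g j\<bar> \<le> (C + D) * (1 + \<bar>of_int j\<bar>) ^ (M + L)" for j
  proof -
    have "\<bar>f j - g j\<bar> \<le> C * (1 + \<bar>of_int j\<bar>) ^ M + D * (1 + \<bar>of_int j\<bar>) ^ L"
      using C[of j] D[of j] by linarith
    also have "\<dots> \<le> C * (1 + \<bar>of_int j\<bar>) ^ (M + L) + D * (1 + \<bar>of_int j\<bar>) ^ (M + L)"
      using \<open>C \<ge> 0\<close> \<open>D \<ge> 0\<close> by (intro add_mono mult_left_mono power_increasing) auto
    finally show ?thesis by (simp add: distrib_right)
  qed
  thus ?thesis unfolding polynomially_bounded_def by blast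
qed

lemma polynomially_bounded_delta_right_power:
  "polynomially_bounded f \<Longrightarrow> polynomially_bounded ((delta_right ^^ l) f)"
  by (induction l) (auto simp: delta_right_def[of "(delta_right ^^ _) _"]
      intro!: polynomially_bounded_diff polynomially_bounded_shift)

lemma summable_on_rapidly_decreasing_mult:
  assumes g: "rapidly_decreasing g" and f: "polynomially_bounded f"
  shows "(\<lambda>j. g (n - j) * f j) summable_on UNIV"
proof -
  obtain C M where C: "\<And>j. \<bar>f j\<bar> \<le> C * (1 + \<bar>of_int j\<bar>) ^ M"
    using f unfolding polynomially_bounded_def by blast
  obtain D where D: "\<And>m. \<bar>g m\<bar> * (1 + \<bar>of_int m\<bar>) ^ (M + 2) \<le> D"
    using g unfolding rapidly_decreasing_def by blast
  have C0: "C \<ge> 0" using C[of 0] by simp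
  define B where "B = C * ((1 + \<bar>of_int n\<bar>) ^ (M + 2) * D) * 4"
  have "(\<lambda>j. \<bar>g (n - j) * f j\<bar>) summable_on UNIV"
  proof (rule summable_on_comparison_test)
    show "(\<lambda>j::int. B * (1 / (1 + (1 + \<bar>of_int j\<bar>))\<^sup>2)) summable_on UNIV"
      by (intro summable_on_cmult_right sum_inverse_square_int_le) simp
    fix j :: int
    define \<rho> where "\<rho> = 1 + \<bar>real_of_int j\<bar>"
    have \<rho>: "\<rho> \<ge> 1" by (simp add: \<rho>_def)
    \<comment> \<open>Moving the centre of the decay from \<open>n\<close> to \<open>0\<close> costs a constant depending on \<open>n\<close>.\<close>
    have "\<rho> \<le> 1 + \<bar>of_int n\<bar> + \<bar>of_int (n - j)\<bar>" unfolding \<rho>_def by simp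
    also have "\<dots> \<le> (1 + \<bar>of_int n\<bar>) * (1 + \<bar>of_int (n - j)\<bar>)"
      unfolding distrib_left distrib_right by simp
    finally have "\<bar>g (n - j)\<bar> * \<rho> ^ (M + 2) \<le>
       \<bar>g (n - j)\<bar> * ((1 + \<bar>of_int n\<bar>) * (1 + \<bar>of_int (n - j)\<bar>)) ^ (M + 2)"
      using \<rho> by (intro mult_left_mono power_mono) auto
    also have "\<dots> = (1 + \<bar>of_int n\<bar>) ^ (M + 2) * (\<bar>g (n - j)\<bar> * (1 + \<bar>of_int (n - j)\<bar>) ^ (M + 2))"
      by (simp only: power_mult_distrib mult_ac)
    also have "\<dots> \<le> (1 + \<bar>of_int n\<bar>) ^ (M + 2) * D" by (intro mult_left_mono D) auto
    finally have gj: "\<bar>g (n - j)\<bar> * \<rho> ^ (M + 2) \<le> (1 + \<bar>of_int n\<bar>) ^ (M + 2) * D" .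
    have "\<bar>g (n - j) * f j\<bar> * \<rho>\<^sup>2 \<le> \<bar>g (n - j)\<bar> * (C * \<rho> ^ M) * \<rho>\<^sup>2"
      using C[of j] by (auto simp: abs_mult \<rho>_def intro!: mult_right_mono mult_left_mono)
    also have "\<dots> = C * (\<bar>g (n - j)\<bar> * \<rho> ^ (M + 2))" by (simp add: power2_eq_square)
    also have "\<dots> \<le> B / 4" unfolding B_def using mult_left_mono[OF gj C0] by simp
    finally have main: "\<bar>g (n - j) * f j\<bar> * \<rho>\<^sup>2 \<le> B / 4" .
    have "\<bar>g (n - j) * f j\<bar> * (1 + \<rho>)\<^sup>2 \<le> \<bar>g (n - j) * f j\<bar> * (2 * \<rho>)\<^sup>2"
      using \<rho> by (intro mult_left_mono power_mono) auto
    also have "\<dots> \<le> B" using main by (simp add: power_mult_distrib)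
    finally show "\<bar>g (n - j) * f j\<bar> \<le> B * (1 / (1 + (1 + \<bar>of_int j\<bar>))\<^sup>2)"
      using \<rho> by (simp add: \<rho>_def[symmetric] pos_le_divide_eq)
  qed simp
  thus ?thesis unfolding real_norm_def [symmetric] by (rule abs_summable_summable)
qed

lemma summation_by_parts:
  assumes g: "rapidly_decreasing g" and f: "polynomially_bounded f"
  shows "(\<Sum>\<^sub>\<infinity>j. g (n - j) * delta_right f j) = (\<Sum>\<^sub>\<infinity>j. delta_right g (n - j) * f j)"
proof -
  let ?s = "\<lambda>j. g (n - j) * f j" and ?a = "\<lambda>j. g (n - j) * f (j + 1)" and ?b = "\<lambda>j. g (n - j + 1) * f j"
  have s: "?s summable_on UNIV" by (rule summable_on_rapidly_decreasing_mult[OF g f])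
  have a: "?a summable_on UNIV"
    by (rule summable_on_rapidly_decreasing_mult[OF g polynomially_bounded_shift[OF f]])
  have b: "?b summable_on UNIV"
    by (rule summable_on_rapidly_decreasing_mult[OF rapidly_decreasing_shift[OF g] f])
  have ab: "infsum ?a UNIV = infsum ?b UNIV"
    by (rule infsum_reindex_bij_witness[where i = "\<lambda>j. j - 1" and j = "\<lambda>j. j + 1"]) auto
  have diff: "infsum (\<lambda>j. ?s j - x j) UNIV = infsum ?s UNIV - infsum x UNIV" if "x summable_on UNIV" for x
    using infsum_add[OF s, of "\<lambda>j. - x j"] that by (simp add: summable_on_uminus infsum_uminus)
  have "(\<Sum>\<^sub>\<infinity>j. g (n - j) * delta_right f j) = infsum (\<lambda>j. ?s j - ?a j) UNIV"
    by (simp add: delta_right_def right_diff_distrib)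
  also have "\<dots> = infsum (\<lambda>j. ?s j - ?b j) UNIV"
    unfolding diff[OF a] diff[OF b] ab ..
  also have "\<dots> = (\<Sum>\<^sub>\<infinity>j. delta_right g (n - j) * f j)"
    by (simp add: delta_right_def left_diff_distrib)
  finally show ?thesis .
qed

text \<open>
  Differencing the data is the same as differencing the kernel. Rapid decrease against polynomial
  growth guarantees that all the series converge, so the shifts of the index are legitimate.
\<close>

lemma summation_by_parts_power:
  assumes "rapidly_decreasing g" "polynomially_bounded f"
  shows "(\<Sum>\<^sub>\<infinity>j. g (n - j) * (delta_right ^^ l) f j) = (\<Sum>\<^sub>\<infinity>j. (delta_right ^^ l) g (n - j) * f j)"
  using assms
proof (induction l arbitrary: g)
  case (Suc l)
  have "(\<Sum>\<^sub>\<infinity>j. g (n - j) * (delta_right ^^ Suc l) f j) =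
     (\<Sum>\<^sub>\<infinity>j. delta_right g (n - j) * (delta_right ^^ l) f j)"
    using summation_by_parts[OF Suc.prems(1) polynomially_bounded_delta_right_power[OF Suc.prems(2)]] by simp
  also have "\<dots> = (\<Sum>\<^sub>\<infinity>j. (delta_right ^^ l) (delta_right g) (n - j) * f j)"
    using Suc.prems by (intro Suc.IH rapidly_decreasing_delta_right)
  finally show ?case by (simp add: funpow_swap1)
qed simp

section \<open>The semigroup at parabolic times\<close>

lemma rapidly_decreasing_heat_kernel:
  assumes t: "t \<ge> 0"
  shows "rapidly_decreasing (heat_kernel t)"
  unfolding rapidly_decreasing_def
proof
  fix N
  obtain C where C: "\<And>m. \<bar>heat_kernel t m\<bar> * (sqrt (1 + t) + \<bar>of_int m\<bar>) ^ N
      \<le> C * sqrt (1 + t) ^ N / sqrt (1 + t) ^ Suc 0"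
    using heat_kernel_diff_bound[of 0 N] t by auto
  have "\<bar>heat_kernel t m\<bar> * (1 + \<bar>of_int m\<bar>) ^ N \<le> \<bar>heat_kernel t m\<bar> * (sqrt (1 + t) + \<bar>of_int m\<bar>) ^ N" for m
    using t by (intro mult_left_mono power_mono) auto
  with C show "\<exists>C. \<forall>m. \<bar>heat_kernel t m\<bar> * (1 + \<bar>of_int m\<bar>) ^ N \<le> C" by (meson order_trans)
qed

lemma weight_pos: "weight \<beta> n > 0"
  by (simp add: weight_def add_pos_nonneg)

lemma weight_le:
  assumes "0 \<le> \<beta>"
  shows "weight \<beta> n \<le> 2 * (1 + \<bar>of_int n\<bar>) powr \<beta>"
proof -
  have "\<bar>real_of_int n\<bar> powr \<beta> \<le> (1 + \<bar>of_int n\<bar>) powr \<beta>" "1 \<le> (1 + \<bar>real_of_int n\<bar>) powr \<beta>"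
    using assms by (auto intro!: powr_mono2 ge_one_powr_ge_zero)
  thus ?thesis by (auto simp: weight_def)
qed

lemma weight_ge:
  assumes "0 \<le> \<beta>"
  shows "(1 + \<bar>of_int n\<bar>) powr \<beta> \<le> 2 powr \<beta> * weight \<beta> n"
proof (cases "n = 0")
  case True
  thus ?thesis using assms ge_one_powr_ge_zero[of 2 \<beta>]
    by (auto simp: weight_def)
next
  case False
  hence "1 \<le> \<bar>real_of_int n\<bar>" by linarith
  hence "(1 + \<bar>of_int n\<bar>) powr \<beta> \<le> (2 * \<bar>of_int n\<bar>) powr \<beta>"
    using assms by (intro powr_mono2) auto
  also have "\<dots> = 2 powr \<beta> * \<bar>of_int n\<bar> powr \<beta>" by (simp add: powr_mult)
  also have "\<dots> \<le> 2 powr \<beta> * weight \<beta> n" by (intro mult_left_mono) (auto simp: weight_def)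
  finally show ?thesis .
qed

text \<open>
  Every single term of the convergent series that defines \<open>ell_mu\<close> is bounded, so \<open>f / weight \<alpha>\<close> grows at
  most linearly.
\<close>

lemma polynomially_bounded_of_ell_mu:
  assumes q: "1 \<le> q" and \<alpha>: "0 \<le> \<alpha>" and f: "(\<lambda>n. f n / weight \<alpha> n) \<in> ell_mu q"
  shows "polynomially_bounded f"
proof -
  let ?h = "\<lambda>j. \<bar>f j / weight \<alpha> j\<bar>"
  let ?c = "\<lambda>j. ?h j powr q * (1 / (1 + \<bar>real_of_int j\<bar>))"
  define A where "A = infsum ?c UNIV"
  have sm: "?c summable_on UNIV" using f by (simp add: ell_mu_def)
  have "\<bar>f j\<bar> \<le> (2 * (1 + A)) * (1 + \<bar>of_int j\<bar>) ^ Suc (nat \<lceil>\<alpha>\<rceil>)" for j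
  proof -
    define \<rho> where "\<rho> = 1 + \<bar>real_of_int j\<bar>"
    have \<rho>: "\<rho> \<ge> 1" by (simp add: \<rho>_def)
    have "sum ?c {j} \<le> A" unfolding A_def by (rule finite_sum_le_infsum[OF sm]) auto
    hence "?h j powr q \<le> A * \<rho>" using \<rho> by (simp add: \<rho>_def[symmetric] pos_divide_le_eq)
    moreover have "?h j \<le> 1 + ?h j powr q" by (intro le_one_plus_powr q) simp
    ultimately have hj: "?h j \<le> (1 + A) * \<rho>" using \<rho> by (simp add: distrib_right)
    have "\<rho> powr \<alpha> \<le> \<rho> powr real (nat \<lceil>\<alpha>\<rceil>)" using \<rho> by (intro powr_mono) linarith+
    hence "\<rho> powr \<alpha> \<le> \<rho> ^ nat \<lceil>\<alpha>\<rceil>" using \<rho> by (simp add: powr_realpow)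
    hence w: "weight \<alpha> j \<le> 2 * \<rho> ^ nat \<lceil>\<alpha>\<rceil>" using weight_le[OF \<alpha>, of j] by (simp add: \<rho>_def)
    have "\<bar>f j\<bar> = ?h j * weight \<alpha> j" using weight_pos[of \<alpha> j] by (simp add: abs_mult)
    also have "\<dots> \<le> ((1 + A) * \<rho>) * (2 * \<rho> ^ nat \<lceil>\<alpha>\<rceil>)"
      using hj w weight_pos[of \<alpha> j] order_trans[OF abs_ge_zero hj] by (intro mult_mono) auto
    finally show ?thesis by (simp add: \<rho>_def[symmetric] algebra_simps)
  qed
  thus ?thesis unfolding polynomially_bounded_def by blast
qed

text \<open>
  At time \<open>n\<^sup>2\<close> the scale \<open>sqrt (1 + n\<^sup>2)\<close> is comparable to \<open>r = 1 + |n|\<close>, and with \<open>\<rho> = 1 + |j|\<close> the sum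
  of the scale and \<open>|n - j|\<close> dominates \<open>r + \<rho>\<close> up to a constant. So the \<open>l\<close>-th difference is at most a
  constant times \<open>r\<^bsup>-l-1\<^esup> (r / (r + \<rho>))\<^sup>N\<close>. Choosing \<open>N \<ge> \<alpha> + 2\<close>, a power \<open>\<alpha>\<close> of the last factor turns the
  weight \<open>\<rho>\<^sup>\<alpha> \<le> (r + \<rho>)\<^sup>\<alpha>\<close> into \<open>r\<^sup>\<alpha>\<close>, and the two remaining powers leave the kernel \<open>r / (r + \<rho>)\<^sup>2\<close>.
\<close>

lemma parabolic_kernel_bound:
  assumes \<alpha>: "real l \<le> \<alpha>"
  shows "\<exists>C. \<forall>n j. \<bar>(delta_right ^^ l) (heat_kernel ((real_of_int n)\<^sup>2)) (n - j)\<bar> * weight \<alpha> j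
     \<le> C * weight (\<alpha> - real l) n * ((1 + \<bar>of_int n\<bar>) / ((1 + \<bar>of_int n\<bar>) + (1 + \<bar>of_int j\<bar>))\<^sup>2)"
proof -
  define N where "N = nat \<lceil>\<alpha> + 2\<rceil>"
  have N: "\<alpha> + 2 \<le> real N" unfolding N_def by linarith
  obtain C where C: "\<And>t m. t \<ge> 0 \<Longrightarrow> \<bar>(delta_right ^^ l) (heat_kernel t) m\<bar> * (sqrt (1 + t) + \<bar>of_int m\<bar>) ^ N
       \<le> C * sqrt (1 + t) ^ N / sqrt (1 + t) ^ Suc l"
    using heat_kernel_diff_bound[of l N] by blast
  have C0: "C \<ge> 0"
  proof -
    have "0 \<le> \<bar>(delta_right ^^ l) (heat_kernel 0) 0\<bar> * (sqrt (1 + 0) + \<bar>of_int 0\<bar>) ^ N" by simp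
    also have "\<dots> \<le> C" using C[of 0 0] by simp
    finally show ?thesis .
  qed
  define A where "A = 4 ^ N * (C * 2 ^ Suc l) * 2 * 2 powr (\<alpha> - l)"
  have "\<bar>(delta_right ^^ l) (heat_kernel ((real_of_int n)\<^sup>2)) (n - j)\<bar> * weight \<alpha> j
     \<le> A * weight (\<alpha> - real l) n * ((1 + \<bar>of_int n\<bar>) / ((1 + \<bar>of_int n\<bar>) + (1 + \<bar>of_int j\<bar>))\<^sup>2)" for n j
  proof -
    define D where "D = \<bar>(delta_right ^^ l) (heat_kernel ((real_of_int n)\<^sup>2)) (n - j)\<bar>"
    define R where "R = sqrt (1 + (real_of_int n)\<^sup>2)"
    define r where "r = 1 + \<bar>real_of_int n\<bar>"
    define \<rho> where "\<rho> = 1 + \<bar>real_of_int j\<bar>"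
    have r: "r \<ge> 1" and \<rho>: "\<rho> \<ge> 1" by (auto simp: r_def \<rho>_def)
    have R1: "R \<ge> 1" by (simp add: R_def)
    have Rr: "R \<le> r" unfolding R_def r_def by (rule real_le_lsqrt) (auto simp: power2_sum)
    have "\<bar>real_of_int n\<bar> \<le> R" unfolding R_def by (rule real_le_rsqrt) simp
    hence rR: "r \<le> 2 * R" using R1 by (simp add: r_def)
    have sum_le: "r + \<rho> \<le> 4 * (R + \<bar>of_int (n - j)\<bar>)"
    proof -
      have "\<rho> \<le> r + \<bar>of_int (n - j)\<bar>" by (simp add: \<rho>_def r_def)
      thus ?thesis using rR by (smt (verit))
    qed
    have "D * (r + \<rho>) ^ N \<le> D * (4 * (R + \<bar>of_int (n - j)\<bar>)) ^ N"
      using sum_le r \<rho> by (intro mult_left_mono power_mono) (auto simp: D_def)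
    also have "\<dots> = 4 ^ N * (D * (R + \<bar>of_int (n - j)\<bar>) ^ N)" by (simp only: power_mult_distrib mult_ac)
    also have "\<dots> \<le> 4 ^ N * (C * R ^ N / R ^ Suc l)"
      using C[of "(real_of_int n)\<^sup>2" "n - j"] unfolding D_def R_def by (intro mult_left_mono) auto
    also have "\<dots> \<le> 4 ^ N * (C * 2 ^ Suc l * (r ^ N / r ^ Suc l))"
    proof -
      have "r ^ Suc l \<le> (2 * R) ^ Suc l" using rR r by (intro power_mono) auto
      hence "1 / R ^ Suc l \<le> 2 ^ Suc l / r ^ Suc l"
        using r R1 unfolding power_mult_distrib by (simp add: divide_simps mult_ac)
      moreover have "R ^ N \<le> r ^ N" using Rr R1 by (intro power_mono) auto
      ultimately have "(C * R ^ N) * (1 / R ^ Suc l) \<le> (C * r ^ N) * (2 ^ Suc l / r ^ Suc l)"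
        using C0 R1 r by (intro mult_mono) auto
      hence "C * R ^ N / R ^ Suc l \<le> C * 2 ^ Suc l * (r ^ N / r ^ Suc l)" by (simp add: mult_ac)
      thus ?thesis by (rule mult_left_mono) simp
    qed
    finally have D: "D * (r + \<rho>) ^ N \<le> 4 ^ N * (C * 2 ^ Suc l) * (r ^ N / r ^ Suc l)" by (simp add: mult_ac)
    define x where "x = r / (r + \<rho>)"
    have x: "0 < x" "x \<le> 1" using r \<rho> by (auto simp: x_def)
    \<comment> \<open>Now the decay in \<open>x = r / (r + \<rho>)\<close> is split: the power \<open>\<alpha>\<close> pays for the weight, the power \<open>2\<close> stays.\<close>
    have D': "D \<le> 4 ^ N * (C * 2 ^ Suc l) * (x ^ N / r ^ Suc l)"
      using D r \<rho> by (simp add: x_def power_divide field_simps)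
    have "x ^ N = x powr N" using x by (simp add: powr_realpow)
    also have "\<dots> \<le> x powr (\<alpha> + 2)" using x N by (intro powr_mono') auto
    finally have xN: "x ^ N \<le> x powr (\<alpha> + 2)" .
    have w: "weight \<alpha> j \<le> 2 * (r + \<rho>) powr \<alpha>"
    proof -
      have "\<rho> powr \<alpha> \<le> (r + \<rho>) powr \<alpha>" using \<alpha> r \<rho> by (intro powr_mono2) auto
      thus ?thesis using weight_le[of \<alpha> j] \<alpha> by (simp add: \<rho>_def)
    qed
    have "D * weight \<alpha> j \<le> (4 ^ N * (C * 2 ^ Suc l) * (x powr (\<alpha> + 2) / r ^ Suc l)) * (2 * (r + \<rho>) powr \<alpha>)"
    proof (rule mult_mono)
      show "D \<le> 4 ^ N * (C * 2 ^ Suc l) * (x powr (\<alpha> + 2) / r ^ Suc l)"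
        using D' xN C0 r by (elim order_trans) (intro mult_left_mono divide_right_mono, auto)
    qed (use w weight_pos[of \<alpha> j] C0 r in auto)
    also have "\<dots> = 4 ^ N * (C * 2 ^ Suc l) * 2 * (x powr (\<alpha> + 2) / r ^ Suc l * (r + \<rho>) powr \<alpha>)"
      by (simp only: mult_ac)
    also have "x powr (\<alpha> + 2) / r ^ Suc l * (r + \<rho>) powr \<alpha> = r powr (\<alpha> - l) * (r / (r + \<rho>)\<^sup>2)"
    proof -
      have "x powr (\<alpha> + 2) = r powr \<alpha> * r\<^sup>2 / ((r + \<rho>) powr \<alpha> * (r + \<rho>)\<^sup>2)"
        using r \<rho> by (simp add: x_def powr_divide powr_add)
      moreover have "r powr (\<alpha> - l) = r powr \<alpha> / r ^ l"
        using r by (simp add: powr_diff powr_realpow)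
      ultimately show ?thesis using r \<rho> by (simp add: power2_eq_square)
    qed
    also have "4 ^ N * (C * 2 ^ Suc l) * 2 * (r powr (\<alpha> - l) * (r / (r + \<rho>)\<^sup>2)) \<le>
        4 ^ N * (C * 2 ^ Suc l) * 2 * ((2 powr (\<alpha> - l) * weight (\<alpha> - l) n) * (r / (r + \<rho>)\<^sup>2))"
      using weight_ge[of "\<alpha> - l" n] \<alpha> C0 r by (intro mult_left_mono mult_right_mono) (auto simp: r_def)
    finally show ?thesis by (simp add: A_def D_def r_def \<rho>_def mult_ac)
  qed
  thus ?thesis by blast
qed

theorem lemma2p5:
  fixes q \<alpha> :: real and l :: nat and f :: "int \<Rightarrow> real"
  assumes "1 \<le> q"
    and "real l \<le> \<alpha>"
    and "(\<lambda>n. f n / weight \<alpha> n) \<in> ell_mu q"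
  shows "(\<forall>n. heat_defined ((real_of_int n)\<^sup>2) ((delta_right ^^ l) f) n) \<and>
    (\<lambda>n. heat_semigroup ((real_of_int n)\<^sup>2) ((delta_right ^^ l) f) n / weight (\<alpha> - real l) n)
      \<in> ell_mu q"
proof
  have "0 \<le> \<alpha>" using assms(2) by simp
  note f = polynomially_bounded_of_ell_mu[OF assms(1) this assms(3)]
  note G = rapidly_decreasing_heat_kernel[OF zero_le_power2]
  show "\<forall>n. heat_defined ((real_of_int n)\<^sup>2) ((delta_right ^^ l) f) n"
    unfolding heat_defined_def
    by (intro allI summable_on_rapidly_decreasing_mult polynomially_bounded_delta_right_power f G)
  let ?T = "\<lambda>n. heat_semigroup ((real_of_int n)\<^sup>2) ((delta_right ^^ l) f) n"
  let ?D = "\<lambda>n j. (delta_right ^^ l) (heat_kernel ((real_of_int n)\<^sup>2)) (n - j)"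
  let ?w = "weight (\<alpha> - real l)"
  define K where "K = (\<lambda>n j::int. (1 + \<bar>real_of_int n\<bar>) / ((1 + \<bar>of_int n\<bar>) + (1 + \<bar>of_int j\<bar>))\<^sup>2)"
  define h where "h = (\<lambda>j. \<bar>f j / weight \<alpha> j\<bar>)"
  obtain C where C: "\<And>n j. \<bar>?D n j\<bar> * weight \<alpha> j \<le> C * ?w n * K n j"
    using parabolic_kernel_bound[OF assms(2)] unfolding K_def by blast
  have Df: "\<bar>?D n j * f j\<bar> \<le> C * ?w n * (K n j * h j)" for n j
  proof -
    have "\<bar>?D n j * f j\<bar> = \<bar>?D n j\<bar> * weight \<alpha> j * h j"
      using weight_pos[of \<alpha> j] by (simp add: h_def abs_mult)
    also have "\<dots> \<le> C * ?w n * K n j * h j" by (intro mult_right_mono C) (simp add: h_def)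
    finally show ?thesis by (simp add: mult.assoc)
  qed
  have Ksm: "K n summable_on UNIV" "infsum (K n) UNIV \<le> 2" for n
  proof -
    have r: "1 + \<bar>real_of_int n\<bar> > 0" by simp
    note s = sum_inverse_square_int_le[OF r]
    have K: "K n = (\<lambda>j. (1 + \<bar>real_of_int n\<bar>) * (1 / ((1 + \<bar>real_of_int n\<bar>) + (1 + \<bar>of_int j\<bar>))\<^sup>2))"
      by (simp add: K_def)
    show "K n summable_on UNIV" unfolding K by (intro summable_on_cmult_right s)
    have "infsum (K n) UNIV \<le> (1 + \<bar>real_of_int n\<bar>) * (2 / (1 + \<bar>real_of_int n\<bar>))"
      unfolding K infsum_cmult_right' using r by (intro mult_left_mono s) auto
    also have "\<dots> = 2" using r by (metis nonzero_mult_div_cancel_left times_divide_eq_right less_irrefl)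
    finally show "infsum (K n) UNIV \<le> 2" .
  qed
  \<comment> \<open>Division by \<open>1 + |n|\<close> makes the kernel symmetric, so the same sum of inverse squares
    bounds the rows and the columns.\<close>
  have Kcol: "(\<lambda>n. 1 / (1 + \<bar>real_of_int n\<bar>) * K n j) summable_on UNIV"
    "infsum (\<lambda>n. 1 / (1 + \<bar>real_of_int n\<bar>) * K n j) UNIV \<le> 2 * (1 / (1 + \<bar>real_of_int j\<bar>))" for j
  proof -
    have r: "1 + \<bar>real_of_int j\<bar> > 0" by simp
    have "1 / (1 + \<bar>real_of_int n\<bar>) * K n j = 1 / ((1 + \<bar>real_of_int j\<bar>) + (1 + \<bar>of_int n\<bar>))\<^sup>2" for n
    proof -
      have "1 + \<bar>real_of_int n\<bar> \<noteq> 0" by linarith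
      thus ?thesis by (simp add: K_def add_ac)
    qed
    with sum_inverse_square_int_le[OF r]
    show "(\<lambda>n. 1 / (1 + \<bar>real_of_int n\<bar>) * K n j) summable_on UNIV"
      "infsum (\<lambda>n. 1 / (1 + \<bar>real_of_int n\<bar>) * K n j) UNIV \<le> 2 * (1 / (1 + \<bar>real_of_int j\<bar>))" by simp_all
  qed
  have hsm: "(\<lambda>j. 1 / (1 + \<bar>real_of_int j\<bar>) * h j powr q) summable_on UNIV"
    using assms(3) by (simp add: ell_mu_def h_def)
  have Knn: "0 \<le> K n j" for n j by (simp add: K_def)
  have hnn: "0 \<le> h j" for j by (simp add: h_def)
  have vpos: "0 < 1 / (1 + \<bar>real_of_int n\<bar>)" for n by (simp add: add_pos_nonneg)
  note Schur = Schur_test[where K = K and h = h and q = q and S = 2 and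
     v = "\<lambda>n. 1 / (1 + \<bar>real_of_int n\<bar>)" and u = "\<lambda>n. 1 / (1 + \<bar>real_of_int n\<bar>)",
     OF assms(1) _ Knn hnn vpos Ksm Kcol hsm, simplified]
  have T: "\<bar>?T n / ?w n\<bar> \<le> C * infsum (\<lambda>j. K n j * h j) UNIV" for n
  proof -
    have "?T n = infsum (\<lambda>j. ?D n j * f j) UNIV"
      unfolding heat_semigroup_def by (rule summation_by_parts_power[OF G f])
    also have "norm \<dots> \<le> infsum (\<lambda>j. C * ?w n * (K n j * h j)) UNIV"
    proof (rule norm_infsum_le)
      show s: "((\<lambda>j. C * ?w n * (K n j * h j)) has_sum infsum (\<lambda>j. C * ?w n * (K n j * h j)) UNIV) UNIV"
        by (intro has_sum_infsum summable_on_cmult_right Schur(1))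
      have "(\<lambda>j. norm (?D n j * f j)) summable_on UNIV"
        by (rule summable_on_comparison_test[OF has_sum_imp_summable[OF s]]) (use Df in auto)
      thus "((\<lambda>j. ?D n j * f j) has_sum infsum (\<lambda>j. ?D n j * f j) UNIV) UNIV"
        by (intro has_sum_infsum) (rule abs_summable_summable)
    qed (use Df in auto)
    also have "\<dots> = C * ?w n * infsum (\<lambda>j. K n j * h j) UNIV" by (rule infsum_cmult_right')
    finally show ?thesis using weight_pos[of "\<alpha> - real l" n] by (simp add: pos_divide_le_eq mult_ac)
  qed
  show "(\<lambda>n. ?T n / ?w n) \<in> ell_mu q"
    unfolding ell_mu_def mem_Collect_eq
  proof (rule summable_on_comparison_test)
    show "(\<lambda>n. \<bar>C\<bar> powr q * (infsum (\<lambda>j. K n j * h j) UNIV powr q / (1 + \<bar>real_of_int n\<bar>))) summable_on UNIV"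
      using Schur(2) by (intro summable_on_cmult_right) 
    fix n :: int
    define I where "I = infsum (\<lambda>j. K n j * h j) UNIV"
    have I: "I \<ge> 0" unfolding I_def by (intro infsum_nonneg mult_nonneg_nonneg Knn hnn)
    have "\<bar>?T n / ?w n\<bar> \<le> \<bar>C\<bar> * I"
      using T[of n] mult_right_mono[OF abs_ge_self[of C] I] unfolding I_def by linarith
    hence "\<bar>?T n / ?w n\<bar> powr q \<le> (\<bar>C\<bar> * I) powr q" using assms(1) by (intro powr_mono2) auto
    also have "\<dots> = \<bar>C\<bar> powr q * I powr q" using I by (simp add: powr_mult)
    finally have "\<bar>?T n / ?w n\<bar> powr q * (1 / (1 + \<bar>real_of_int n\<bar>)) \<le> \<bar>C\<bar> powr q * I powr q * (1 / (1 + \<bar>real_of_int n\<bar>))"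
      by (rule mult_right_mono) simp
    thus "\<bar>?T n / ?w n\<bar> powr q * (1 / (1 + \<bar>real_of_int n\<bar>)) \<le>
        \<bar>C\<bar> powr q * (infsum (\<lambda>j. K n j * h j) UNIV powr q / (1 + \<bar>real_of_int n\<bar>))"
      by (simp add: I_def)
  qed simp
qed

end
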